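(* Let $\mathbb{D}_Q\subset\mathbb{M}^d$ be an NC matrix unit ball, where $Q(X)=\sum_{j=1}^dQ_j\otimes X_j$ with $Q_1,\dots,Q_d\in M_{s\times r}$ linearly independent. Let $f\in\mathcal{SA}(\mathbb{D}_Q)$ be a non-constant NC function admitting a unitary realization $$f(X)=A^{(n)}+B^{(n)}\bigl[I-(Q(X)\otimes I_{\mathcal{H}})D^{(n)}\bigr]^{-1}(Q(X)\otimes I_{\mathcal{H}})C^{(n)}$$ for all $n\in\mathbb{N}$ and all $X\in\mathbb{D}_Q\cap(M_{n\times n}\otimes\mathbb{C}^d)$, where $\mathcal{H}$ is a Hilbert space and $$V=\begin{bmatrix}A&B\\ C&D\end{bmatrix}:\begin{bmatrix}\mathbb{C}\\ \mathbb{C}^s\otimes\mathcal{H}\end{bmatrix}\to\begin{bmatrix}\mathbb{C}\\ \mathbb{C}^r\otimes\mathcal{H}\end{bmatrix}$$ is a unitary operator. Then $$\mathcal{Z}_{\partial\mathbb{D}_Q}(f)\subseteq\sigma_{ap}^Q(D^* )\cap\partial\mathbb{D}_Q .$$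
   Context: $\mathbb{M}^d=\bigsqcup_{n\in\mathbb{N}}M_{n\times n}\otimes\mathbb{C}^d$ is the disjoint union over $n$ of the spaces of $d$-tuples $X=(X_1,\dots,X_d)$ of complex $n\times n$ matrices (level $n$); for $\Omega\subset\mathbb{M}^d$, $\Omega_n=\Omega\cap(M_{n\times n}\otimes\mathbb{C}^d)$. For $X$ at level $n$, $Q(X)=\sum_jQ_j\otimes X_j:\mathbb{C}^r\otimes\mathbb{C}^n\to\mathbb{C}^s\otimes\mathbb{C}^n$. $\mathbb{D}_Q=\{X\in\mathbb{M}^d:\|Q(X)\|<1\}$ and $\partial\mathbb{D}_Q=\{X\in\mathbb{M}^d:\|Q(X)\|=1\}$ (operator norm). An NC function $f:\mathbb{D}_Q\to\mathbb{M}^1$ is a map such that: $f(X)\in M_{n\times n}$ for $X$ at level $n$; $f(X\oplus Y)=f(X)\oplus f(Y)$ (direct sums taken componentwise); and $f(S^{-1}XS)=S^{-1}f(X)S$ whenever $X\in(\mathbb{D}_Q)_n$, $S\in GL_n$ and $S^{-1}XS=(S^{-1}X_1S,\dots,S^{-1}X_dS)\in(\mathbb{D}_Q)_n$. $\mathcal{SA}(\mathbb{D}_Q)$ is the set of NC functions $f:\mathbb{D}_Q\to\mathbb{M}^1$ with $\sup_{X\in\mathbb{D}_Q}\|f(X)\|\le1$. For an operator $T$, $T^{(n)}=T\otimes I_n$. For $X$ at level $n$, $Q(X)\otimes I_{\mathcal{H}}$ denotes, after the obvious reordering of tensor factors, the operator $\sum_jQ_j\otimes I_{\mathcal{H}}\otimes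 X_j:\mathbb{C}^r\otimes\mathcal{H}\otimes\mathbb{C}^n\to\mathbb{C}^s\otimes\mathcal{H}\otimes\mathbb{C}^n$. Boundary zero locus: $\Lambda\in(\partial\mathbb{D}_Q)_n$ is a boundary zero of $f$ if there is $0\ne y\in\mathbb{C}^n$ with $\lim_{r\to1^-}f(r\Lambda)y=0$. $\mathcal{Z}_{\partial\mathbb{D}_Q}(f)$ is the set (disjoint union over $n$) of all boundary zeros of $f$. NC $Q$-approximate spectrum: for $T\in\mathcal{B}(\mathbb{C}^r\otimes\mathcal{H},\mathbb{C}^s\otimes\mathcal{H})$, $\Lambda\in M_{n\times n}\otimes\mathbb{C}^d$ is an NC $Q$-approximate eigenvalue of $T$ at level $n$ if there is a sequence of unit vectors $\vec v_k\in\mathbb{C}^r\otimes\mathcal{H}\otimes\mathbb{C}^n$ with $\lim_{k\to\infty}\|T^{(n)}\vec v_k-(Q(\Lambda)\otimes I_{\mathcal{H}})\vec v_k\|=0$. $\sigma_{ap}^Q(T)$ is the set (disjoint union over $n$) of all NC $Q$-approximate eigenvalues of $T$. *)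

theory Defs
  imports "Jordan_Normal_Form.Matrix" "HOL-Analysis.Analysis"
begin

no_notation Matrix.vec_index (infixl \<open>$\<close> 100)
hide_type (open) Matrix.vec
hide_const (open) Matrix.vec

section \<open>Complex Hilbert spaces\<close>

text \<open>The inner product is linear in its first argument. Positive definiteness and the formula
  for the norm are inherited from the class \<^class>\<open>real_inner\<close> through the last axiom.\<close>

class complex_hilbert = real_inner + complete_space +
  fixes scaleC :: "complex \<Rightarrow> 'a \<Rightarrow> 'a" (infixr \<open>*\<^sub>C\<close> 75)
    and cinner :: "'a \<Rightarrow> 'a \<Rightarrow> complex"
  assumes scaleC_add_right: "c *\<^sub>C (x + y) = c *\<^sub>C x + c *\<^sub>C y"
    and scaleC_add_left: "(b + c) *\<^sub>C x = b *\<^sub>C x + c *\<^sub>C x"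
    and scaleC_scaleC: "b *\<^sub>C (c *\<^sub>C x) = (b * c) *\<^sub>C x"
    and scaleR_scaleC: "scaleR a x = complex_of_real a *\<^sub>C x"
    and cinner_add_left: "cinner (x + y) z = cinner x z + cinner y z"
    and cinner_scaleC_left: "cinner (c *\<^sub>C x) y = c * cinner x y"
    and cinner_commute: "cinner x y = cnj (cinner y x)"
    and inner_eq_Re_cinner: "inner x y = Re (cinner x y)"

instantiation complex :: complex_hilbert
begin
definition scaleC_complex :: "complex \<Rightarrow> complex \<Rightarrow> complex" where
  "scaleC_complex c x = c * x"
definition cinner_complex :: "complex \<Rightarrow> complex \<Rightarrow> complex" where
  "cinner_complex x y = x * cnj y"
instance
  by standard
    (auto simp: scaleC_complex_def cinner_complex_def inner_complex_def algebra_simps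
      scaleR_conv_of_real)
end

instantiation prod :: (complex_hilbert, complex_hilbert) complex_hilbert
begin
definition scaleC_prod :: "complex \<Rightarrow> 'a \<times> 'b \<Rightarrow> 'a \<times> 'b" where
  "scaleC_prod c x = (c *\<^sub>C fst x, c *\<^sub>C snd x)"
definition cinner_prod :: "'a \<times> 'b \<Rightarrow> 'a \<times> 'b \<Rightarrow> complex" where
  "cinner_prod x y = cinner (fst x) (fst y) + cinner (snd x) (snd y)"
instance
proof
  fix x y :: "'a \<times> 'b"
  show "cinner x y = cnj (cinner y x)"
    unfolding cinner_prod_def complex_cnj_add
    by (simp only: cinner_commute[of "fst x"] cinner_commute[of "snd x"])
qed (auto simp: scaleC_prod_def cinner_prod_def inner_prod_def scaleC_add_right scaleC_add_left
      scaleC_scaleC scaleR_scaleC cinner_add_left cinner_scaleC_left inner_eq_Re_cinner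
      algebra_simps prod_eq_iff)
end

text \<open>The space \<open>\<complex>\<^sup>m \<otimes> \<H>\<close> is the \<open>m\<close>-fold orthogonal sum of \<open>\<H>\<close>.\<close>

instantiation vec :: (complex_hilbert, finite) complex_hilbert
begin
definition scaleC_vec :: "complex \<Rightarrow> 'a ^ 'b \<Rightarrow> 'a ^ 'b" where
  "scaleC_vec c x = (\<chi> i. c *\<^sub>C x $ i)"
definition cinner_vec :: "'a ^ 'b \<Rightarrow> 'a ^ 'b \<Rightarrow> complex" where
  "cinner_vec x y = (\<Sum>i\<in>UNIV. cinner (x $ i) (y $ i))"
instance
proof
  fix x y :: "'a ^ 'b"
  show "cinner x y = cnj (cinner y x)"
    unfolding cinner_vec_def cnj_sum by (intro sum.cong refl cinner_commute)
qed (auto simp: scaleC_vec_def cinner_vec_def inner_vec_def scaleC_add_right scaleC_add_left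
      scaleC_scaleC scaleR_scaleC cinner_add_left cinner_scaleC_left inner_eq_Re_cinner
      Finite_Cartesian_Product.vec_eq_iff sum.distrib sum_distrib_left)
end

definition bounded_clinear :: "('a::complex_hilbert \<Rightarrow> 'b::complex_hilbert) \<Rightarrow> bool" where
  "bounded_clinear T \<longleftrightarrow> bounded_linear T \<and> (\<forall>c x. T (c *\<^sub>C x) = c *\<^sub>C T x)"

definition unitary :: "('a::complex_hilbert \<Rightarrow> 'b::complex_hilbert) \<Rightarrow> bool" where
  "unitary V \<longleftrightarrow> bounded_clinear V \<and> surj V \<and> (\<forall>x y. cinner (V x) (V y) = cinner x y)"

definition cadjoint :: "('a::complex_hilbert \<Rightarrow> 'b::complex_hilbert) \<Rightarrow> 'b \<Rightarrow> 'a" where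
  "cadjoint T = (THE T'. \<forall>x y. cinner (T x) y = cinner x (T' y))"

definition block_op ::
  "('a \<Rightarrow> 'c) \<Rightarrow> ('b \<Rightarrow> 'c) \<Rightarrow> ('a \<Rightarrow> 'e) \<Rightarrow> ('b \<Rightarrow> 'e) \<Rightarrow> 'a \<times> 'b \<Rightarrow> 'c::plus \<times> 'e::plus" where
  "block_op A B C D = (\<lambda>(z, u). (A z + B u, C z + D u))"


section \<open>Ampliations\<close>

text \<open>Since \<open>n\<close> ranges over all positive integers, \<open>E \<otimes> \<complex>\<^sup>n\<close> is realized as the
  space of sequences in \<open>E\<close> that vanish from index \<open>n\<close> on. For \<open>E = \<complex>\<close> this is \<open>\<complex>\<^sup>n\<close>.\<close>

definition amp :: "nat \<Rightarrow> (nat \<Rightarrow> 'a::complex_hilbert) set" where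
  "amp n = {v. \<forall>i\<ge>n. v i = 0}"

definition amp_norm :: "nat \<Rightarrow> (nat \<Rightarrow> 'a::complex_hilbert) \<Rightarrow> real" where
  "amp_norm n v = L2_set (\<lambda>i. norm (v i)) {..<n}"

definition amp_opnorm ::
  "nat \<Rightarrow> ((nat \<Rightarrow> 'a::complex_hilbert) \<Rightarrow> (nat \<Rightarrow> 'b::complex_hilbert)) \<Rightarrow> real" where
  "amp_opnorm n T = (SUP v\<in>{v \<in> amp n. amp_norm n v \<le> 1}. amp_norm n (T v))"

text \<open>\<open>ampliate T\<close> is \<open>T \<otimes> I\<^sub>n\<close>; its restriction to \<open>amp n\<close> is meant.\<close>

definition ampliate :: "('a \<Rightarrow> 'b) \<Rightarrow> (nat \<Rightarrow> 'a) \<Rightarrow> nat \<Rightarrow> 'b" where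
  "ampliate T v = (\<lambda>i. T (v i))"

text \<open>\<open>mat_act n M\<close> is \<open>I\<^sub>E \<otimes> M\<close> for an \<open>n \<times> n\<close> matrix \<open>M\<close>; for \<open>E = \<complex>\<close> it is \<open>M\<close> itself,
  as an operator on \<open>\<complex>\<^sup>n\<close>.\<close>

definition mat_act ::
  "nat \<Rightarrow> complex mat \<Rightarrow> (nat \<Rightarrow> 'a::complex_hilbert) \<Rightarrow> nat \<Rightarrow> 'a" where
  "mat_act n M v = (\<lambda>i. if i < n then \<Sum>k<n. M $$ (i, k) *\<^sub>C v k else 0)"

definition mat_opnorm :: "nat \<Rightarrow> complex mat \<Rightarrow> real" where
  "mat_opnorm n M = amp_opnorm n (mat_act n M :: (nat \<Rightarrow> complex) \<Rightarrow> nat \<Rightarrow> complex)"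

text \<open>\<open>tensor_id P\<close> is \<open>P \<otimes> I\<^sub>\<H>\<close> for an \<open>s \<times> r\<close> matrix \<open>P\<close>.\<close>

definition tensor_id ::
  "complex ^ 'r ^ 's \<Rightarrow> ('h::complex_hilbert) ^ 'r::finite \<Rightarrow> 'h ^ 's::finite" where
  "tensor_id P w = (\<chi> a. \<Sum>b\<in>UNIV. (P $ a $ b) *\<^sub>C (w $ b))"

text \<open>\<open>Q_op Q n X\<close> is \<open>\<Sum>\<^sub>j Q\<^sub>j \<otimes> I\<^sub>\<H> \<otimes> X\<^sub>j\<close>. At \<open>\<H> = \<complex>\<close> it is \<open>Q(X)\<close>, and \<open>Q_norm\<close> is the
  norm of the latter.\<close>

definition Q_op ::
  "('d::finite \<Rightarrow> complex ^ 'r ^ 's) \<Rightarrow> nat \<Rightarrow> ('d \<Rightarrow> complex mat)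
    \<Rightarrow> (nat \<Rightarrow> ('h::complex_hilbert) ^ 'r::finite) \<Rightarrow> nat \<Rightarrow> 'h ^ 's::finite" where
  "Q_op Q n X v = (\<lambda>i. \<Sum>j\<in>UNIV. tensor_id (Q j) (mat_act n (X j) v i))"

definition Q_norm ::
  "('d::finite \<Rightarrow> complex ^ 'r::finite ^ 's::finite) \<Rightarrow> nat \<Rightarrow> ('d \<Rightarrow> complex mat) \<Rightarrow> real" where
  "Q_norm Q n X =
    amp_opnorm n (Q_op Q n X :: (nat \<Rightarrow> complex ^ 'r) \<Rightarrow> nat \<Rightarrow> complex ^ 's)"


section \<open>NC functions on the matrix unit ball\<close>

text \<open>A point of the \<open>d\<close>-dimensional NC universe is a tuple of square matrices of the same
  positive size. As a \<^typ>\<open>'a mat\<close> carries its dimensions, the levels are disjoint.\<close>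

definition level :: "nat \<Rightarrow> ('d \<Rightarrow> complex mat) set" where
  "level n = {X. \<forall>j. X j \<in> carrier_mat n n}"

definition nc_ball :: "('d::finite \<Rightarrow> complex ^ 'r::finite ^ 's::finite) \<Rightarrow> ('d \<Rightarrow> complex mat) set"
  where "nc_ball Q = {X. \<exists>n\<ge>1. X \<in> level n \<and> Q_norm Q n X < 1}"

definition nc_boundary ::
  "('d::finite \<Rightarrow> complex ^ 'r::finite ^ 's::finite) \<Rightarrow> ('d \<Rightarrow> complex mat) set" where
  "nc_boundary Q = {X. \<exists>n\<ge>1. X \<in> level n \<and> Q_norm Q n X = 1}"

definition dsum :: "complex mat \<Rightarrow> complex mat \<Rightarrow> complex mat" where
  "dsum M N = four_block_mat M (0\<^sub>m (dim_row M) (dim_col N)) (0\<^sub>m (dim_row N) (dim_col M)) N"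

definition nc_function ::
  "('d::finite \<Rightarrow> complex ^ 'r::finite ^ 's::finite)
    \<Rightarrow> (('d \<Rightarrow> complex mat) \<Rightarrow> complex mat) \<Rightarrow> bool" where
  "nc_function Q f \<longleftrightarrow>
    (\<forall>n. \<forall>X \<in> nc_ball Q \<inter> level n. f X \<in> carrier_mat n n) \<and>
    (\<forall>X \<in> nc_ball Q. \<forall>Y \<in> nc_ball Q. f (\<lambda>j. dsum (X j) (Y j)) = dsum (f X) (f Y)) \<and>
    (\<forall>n. \<forall>X \<in> nc_ball Q \<inter> level n. \<forall>S \<in> carrier_mat n n. \<forall>S' \<in> carrier_mat n n.
      inverts_mat S S' \<longrightarrow> inverts_mat S' S \<longrightarrow> (\<lambda>j. S' * X j * S) \<in> nc_ball Q \<longrightarrow>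
      f (\<lambda>j. S' * X j * S) = S' * f X * S)"

definition schur_agler ::
  "('d::finite \<Rightarrow> complex ^ 'r::finite ^ 's::finite)
    \<Rightarrow> (('d \<Rightarrow> complex mat) \<Rightarrow> complex mat) set" where
  "schur_agler Q =
    {f. nc_function Q f \<and> (\<forall>n. \<forall>X \<in> nc_ball Q \<inter> level n. mat_opnorm n (f X) \<le> 1)}"

definition nc_constant ::
  "('d::finite \<Rightarrow> complex ^ 'r::finite ^ 's::finite)
    \<Rightarrow> (('d \<Rightarrow> complex mat) \<Rightarrow> complex mat) \<Rightarrow> bool" where
  "nc_constant Q f \<longleftrightarrow> (\<exists>c. \<forall>n. \<forall>X \<in> nc_ball Q \<inter> level n. f X = c \<cdot>\<^sub>m 1\<^sub>m n)"

text \<open>The operator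
  \<open>A\<^sup>(\<^sup>n\<^sup>) + B\<^sup>(\<^sup>n\<^sup>) [I - (Q(X) \<otimes> I\<^sub>\<H>) D\<^sup>(\<^sup>n\<^sup>)]\<inverse> (Q(X) \<otimes> I\<^sub>\<H>) C\<^sup>(\<^sup>n\<^sup>)\<close> on \<open>\<complex>\<^sup>n\<close>. The inverse is taken on
  \<open>\<complex>\<^sup>s \<otimes> \<H> \<otimes> \<complex>\<^sup>n\<close>; it exists whenever \<open>D\<close> is a contraction and \<open>X\<close> lies in the ball.\<close>

definition transfer_op ::
  "('d::finite \<Rightarrow> complex ^ 'r ^ 's) \<Rightarrow> (complex \<Rightarrow> complex) \<Rightarrow> ('h ^ 's \<Rightarrow> complex)
    \<Rightarrow> (complex \<Rightarrow> ('h::complex_hilbert) ^ 'r::finite) \<Rightarrow> ('h ^ 's::finite \<Rightarrow> 'h ^ 'r)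
    \<Rightarrow> nat \<Rightarrow> ('d \<Rightarrow> complex mat) \<Rightarrow> (nat \<Rightarrow> complex) \<Rightarrow> nat \<Rightarrow> complex" where
  "transfer_op Q A B C D n X y = (\<lambda>i. ampliate A y i +
     ampliate B (inv_into (amp n) (\<lambda>u i. u i - Q_op Q n X (ampliate D u) i)
                   (Q_op Q n X (ampliate C y))) i)"


section \<open>Boundary zeros and the NC approximate point spectrum\<close>

definition boundary_zeros ::
  "('d::finite \<Rightarrow> complex ^ 'r::finite ^ 's::finite)
    \<Rightarrow> (('d \<Rightarrow> complex mat) \<Rightarrow> complex mat) \<Rightarrow> ('d \<Rightarrow> complex mat) set" where
  "boundary_zeros Q f =
    {\<Lambda>. \<exists>n\<ge>1. \<Lambda> \<in> nc_boundary Q \<inter> level n \<and>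
      (\<exists>y :: nat \<Rightarrow> complex. y \<in> amp n \<and> y \<noteq> (\<lambda>_. 0) \<and>
        ((\<lambda>t :: real. amp_norm n (mat_act n (f (\<lambda>j. complex_of_real t \<cdot>\<^sub>m \<Lambda> j)) y))
          \<longlongrightarrow> 0) (at_left 1))}"

definition approx_spectrum ::
  "('d::finite \<Rightarrow> complex ^ 'r ^ 's)
    \<Rightarrow> (('h::complex_hilbert) ^ 'r::finite \<Rightarrow> 'h ^ 's::finite) \<Rightarrow> ('d \<Rightarrow> complex mat) set" where
  "approx_spectrum Q T =
    {\<Lambda>. \<exists>n\<ge>1. \<Lambda> \<in> level n \<and>
      (\<exists>v :: nat \<Rightarrow> nat \<Rightarrow> 'h ^ 'r. (\<forall>k. v k \<in> amp n \<and> amp_norm n (v k) = 1) \<and>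
        (\<lambda>k. amp_norm n (\<lambda>i. ampliate T (v k) i - Q_op Q n \<Lambda> (v k) i)) \<longlonglongrightarrow> 0)}"

end

theory Submission
  imports Defs
begin

text \<open>Fix \<open>\<Lambda>\<close> on the boundary at level \<open>n\<close> and \<open>0 \<noteq> y \<in> \<complex>\<^sup>n\<close> with \<open>f(t\<Lambda>) y \<rightarrow> 0\<close> as
  \<open>t \<rightarrow> 1\<close> from below. Write \<open>P\<^sub>t = Q(t\<Lambda>) \<otimes> I = t (Q(\<Lambda>) \<otimes> I)\<close> and, omitting the
  ampliation superscripts, let
  \<open>u = (I - P\<^sub>t D)\<inverse> P\<^sub>t C y\<close> and \<open>w = C y + D u\<close>. Then \<open>u = P\<^sub>t w\<close>, and the realization
  formula says exactly that the unitary \<open>V\<close> maps \<open>(y, P\<^sub>t w)\<close> to \<open>(f(t\<Lambda>) y, w)\<close>.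

  Two consequences are drawn from this one identity (lemma \<open>realization_state\<close>). As \<open>V\<close> is
  isometric, \<open>\<parallel>y\<parallel>\<^sup>2 + \<parallel>P\<^sub>t w\<parallel>\<^sup>2 = \<parallel>f(t\<Lambda>) y\<parallel>\<^sup>2 + \<parallel>w\<parallel>\<^sup>2\<close>, so \<open>\<parallel>w\<parallel>\<close> stays bounded away from \<open>0\<close>
  when \<open>f(t\<Lambda>) y\<close> tends to \<open>0\<close>. Applying \<open>V\<inverse> = V\<^sup>*\<close> and reading off the second component,
  \<open>D\<^sup>* w - P\<^sub>t w = - B\<^sup>* f(t\<Lambda>) y\<close>, so \<open>\<parallel>D\<^sup>* w - P\<^sub>t w\<parallel> \<le> \<parallel>f(t\<Lambda>) y\<parallel>\<close>. Since
  \<open>\<parallel>P\<^sub>t w - (Q(\<Lambda>) \<otimes> I) w\<parallel> \<le> (1 - t) \<parallel>w\<parallel>\<close>, the normalized vectors \<open>w / \<parallel>w\<parallel>\<close> are approximate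
  eigenvectors of \<open>D\<^sup>*\<close> at \<open>\<Lambda>\<close>.

  Two analytic facts support the argument. The norm of \<open>Q(X)\<close> is a supremum over scalar vectors,
  and tensoring with the identity of a Hilbert space must not increase it
  (lemmas \<open>matrix_bound_tensor_hilbert\<close> and \<open>Q_op_bound\<close>). The operator \<open>I - P\<^sub>t D\<close> must be
  onto for the inverse in the realization to be a genuine one; as \<open>P\<^sub>t D\<close> is a strict
  contraction, this is a fixed point argument (lemma \<open>amp_fixed_point\<close>).\<close>

section \<open>Complex Hilbert spaces\<close>

text \<open>Completeness is what the comparison test for series in the fixed point argument rests on.\<close>

instance complex_hilbert \<subseteq> banach ..

lemma scaleC_zero_left [simp]: "0 *\<^sub>C (x::'a::complex_hilbert) = 0"
  using scaleC_add_left[of 0 0 x] by simp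

lemma scaleC_zero_right [simp]: "c *\<^sub>C (0::'a::complex_hilbert) = 0"
  using scaleC_add_right[of c 0 "0::'a"] by simp

lemma scaleC_one [simp]: "1 *\<^sub>C (x::'a::complex_hilbert) = x"
  using scaleR_scaleC[of 1 x] by simp

lemma scaleC_vec_nth [simp]: "(c *\<^sub>C x) $ i = c *\<^sub>C (x $ i)"
  by (simp add: scaleC_vec_def)

lemma scaleC_minus_right: "c *\<^sub>C (- x) = - (c *\<^sub>C (x::'a::complex_hilbert))"
  using scaleC_add_right[of c x "- x"] by (simp add: eq_neg_iff_add_eq_0 add.commute)

lemma scaleC_diff_right: "c *\<^sub>C (x - y) = c *\<^sub>C x - c *\<^sub>C (y::'a::complex_hilbert)"
  using scaleC_add_right[of c x "- y"] by (simp add: scaleC_minus_right)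

lemma scaleC_sum_right:
  "c *\<^sub>C (\<Sum>i\<in>S. g i) = (\<Sum>i\<in>S. c *\<^sub>C (g i::'a::complex_hilbert))"
  by (induction S rule: infinite_finite_induct) (auto simp: scaleC_add_right)

lemma scaleC_sum_left:
  "(\<Sum>i\<in>S. g i) *\<^sub>C (x::'a::complex_hilbert) = (\<Sum>i\<in>S. g i *\<^sub>C x)"
  by (induction S rule: infinite_finite_induct) (auto simp: scaleC_add_left)

lemma cinner_zero_left [simp]: "cinner 0 (y::'a::complex_hilbert) = 0"
  using cinner_add_left[of 0 0 y] by simp

lemma cinner_zero_right [simp]: "cinner (x::'a::complex_hilbert) 0 = 0"
  using cinner_commute[of x 0] by simp

lemma cinner_diff_left:
  "cinner (x - z) y = cinner x y - cinner z (y::'a::complex_hilbert)"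
  using cinner_add_left[of "x - z" z y] by simp

lemma cinner_sum_left:
  "cinner (\<Sum>i\<in>S. g i) (y::'a::complex_hilbert) = (\<Sum>i\<in>S. cinner (g i) y)"
  by (induction S rule: infinite_finite_induct) (auto simp: cinner_add_left)

lemma cinner_scaleC_right: "cinner x (c *\<^sub>C y) = cnj c * cinner x (y::'a::complex_hilbert)"
  by (metis cinner_commute cinner_scaleC_left complex_cnj_mult)

lemma cinner_diff_right:
  "cinner x (y - z) = cinner x y - cinner x (z::'a::complex_hilbert)"
  by (metis cinner_commute cinner_diff_left complex_cnj_diff)

lemma cinner_same: "cinner x (x::'a::complex_hilbert) = complex_of_real ((norm x)\<^sup>2)"
proof (rule complex_eqI)
  show "Im (cinner x x) = Im (complex_of_real ((norm x)\<^sup>2))"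
    using arg_cong[OF cinner_commute[of x x], of Im] by simp
qed (simp add: inner_eq_Re_cinner[symmetric] dot_square_norm)

lemma cinner_right_eqI:
  fixes y z :: "'a::complex_hilbert"
  assumes "\<And>x. cinner x y = cinner x z"
  shows "y = z"
proof -
  have "cinner (y - z) (y - z) = 0"
    by (simp add: cinner_diff_right assms)
  then show ?thesis by (simp add: cinner_same)
qed

lemma norm_scaleC: "norm (c *\<^sub>C (x::'a::complex_hilbert)) = cmod c * norm x"
proof -
  have "complex_of_real ((norm (c *\<^sub>C x))\<^sup>2) = (c * cnj c) * complex_of_real ((norm x)\<^sup>2)"
    by (simp only: cinner_same[symmetric] cinner_scaleC_left cinner_scaleC_right mult_ac)
  also have "\<dots> = complex_of_real ((cmod c * norm x)\<^sup>2)"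
    by (simp add: complex_norm_square[symmetric] power_mult_distrib)
  finally have "(norm (c *\<^sub>C x))\<^sup>2 = (cmod c * norm x)\<^sup>2"
    by (simp only: of_real_eq_iff)
  then show ?thesis by simp
qed

lemma bounded_clinearD:
  assumes "bounded_clinear T"
  shows "T 0 = 0" "T (x + y) = T x + T y" "T (x - y) = T x - T y" "T (c *\<^sub>C x) = c *\<^sub>C T x"
proof -
  have T: "bounded_linear T" and c: "\<And>c x. T (c *\<^sub>C x) = c *\<^sub>C T x"
    using assms by (auto simp: bounded_clinear_def)
  interpret bounded_linear T by fact
  show "T 0 = 0" "T (x + y) = T x + T y" "T (x - y) = T x - T y" "T (c *\<^sub>C x) = c *\<^sub>C T x"
    by (simp_all add: zero add diff c)
qed


section \<open>Scalar bounds for matrices acting on Hilbert space vectors\<close>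

lemma norm_orthogonal_split:
  fixes e w :: "'a::complex_hilbert"
  assumes "norm e = 1" "cinner w e = 0"
  shows "(norm (a *\<^sub>C e + w))\<^sup>2 = (cmod a)\<^sup>2 + (norm w)\<^sup>2"
proof -
  have "cinner e w = 0" using assms(2) cinner_commute[of e w] by simp
  then have "inner (a *\<^sub>C e) w = 0"
    by (simp add: inner_eq_Re_cinner cinner_scaleC_left)
  then have "(norm (a *\<^sub>C e + w))\<^sup>2 = (norm (a *\<^sub>C e))\<^sup>2 + (norm w)\<^sup>2"
    by (simp add: power2_norm_eq_inner inner_add inner_commute)
  then show ?thesis by (simp add: norm_scaleC assms(1))
qed

text \<open>This is \<open>\<parallel>M \<otimes> I\<parallel> \<le> \<parallel>M\<parallel>\<close>. One direction of the Hilbert space is peeled off at a time: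
  with \<open>e\<close> the normalization of some nonzero \<open>w m\<close>, split every \<open>w j\<close> into a multiple of \<open>e\<close> and
  a part orthogonal to \<open>e\<close>. By Pythagoras both sides split accordingly; the \<open>e\<close>-part is the scalar
  bound, and the orthogonal parts form a family with fewer nonzero members, because the part of
  \<open>w m\<close> vanishes.\<close>

lemma matrix_bound_tensor_hilbert:
  fixes M :: "'i \<Rightarrow> 'j \<Rightarrow> complex" and w :: "'j \<Rightarrow> 'h::complex_hilbert"
  assumes fin: "finite J"
    and bound: "\<And>z. (\<Sum>i\<in>I. (cmod (\<Sum>j\<in>J. M i j * z j))\<^sup>2) \<le> K * (\<Sum>j\<in>J. (cmod (z j))\<^sup>2)"
  shows "(\<Sum>i\<in>I. (norm (\<Sum>j\<in>J. M i j *\<^sub>C w j))\<^sup>2) \<le> K * (\<Sum>j\<in>J. (norm (w j))\<^sup>2)"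
proof (induction "card {j\<in>J. w j \<noteq> 0}" arbitrary: w rule: less_induct)
  case less
  show ?case
  proof (cases "\<forall>j\<in>J. w j = 0")
    case True
    then show ?thesis by simp
  next
    case False
    then obtain m where m: "m \<in> J" "w m \<noteq> 0" by blast
    define e where "e = complex_of_real (1 / norm (w m)) *\<^sub>C w m"
    define a where "a j = cinner (w j) e" for j
    define w' where "w' j = w j - a j *\<^sub>C e" for j
    have e: "norm e = 1"
      using m by (simp add: e_def norm_scaleC norm_divide)
    have w: "w j = a j *\<^sub>C e + w' j" for j
      by (simp add: w'_def)
    have orth: "cinner (w' j) e = 0" for j
      by (simp add: w'_def a_def cinner_diff_left cinner_scaleC_left cinner_same e)
    have "a m = complex_of_real (norm (w m))"
      using m unfolding a_def e_def
      by (simp add: cinner_scaleC_right cinner_same power2_eq_square)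
    then have "w' m = 0"
      using m by (simp add: w'_def e_def scaleC_scaleC flip: scaleR_scaleC)
    have "w' j = 0" if "w j = 0" for j
      using that by (simp add: w'_def a_def)
    then have "{j\<in>J. w' j \<noteq> 0} \<subset> {j\<in>J. w j \<noteq> 0}"
      using m \<open>w' m = 0\<close> by blast
    then have "card {j\<in>J. w' j \<noteq> 0} < card {j\<in>J. w j \<noteq> 0}"
      by (intro psubset_card_mono) (use fin in auto)
    from less(1)[OF this]
    have IH: "(\<Sum>i\<in>I. (norm (\<Sum>j\<in>J. M i j *\<^sub>C w' j))\<^sup>2) \<le> K * (\<Sum>j\<in>J. (norm (w' j))\<^sup>2)" .
    have row: "(norm (\<Sum>j\<in>J. M i j *\<^sub>C w j))\<^sup>2
        = (cmod (\<Sum>j\<in>J. M i j * a j))\<^sup>2 + (norm (\<Sum>j\<in>J. M i j *\<^sub>C w' j))\<^sup>2" for i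
    proof -
      have "(\<Sum>j\<in>J. M i j *\<^sub>C w j) = (\<Sum>j\<in>J. M i j * a j) *\<^sub>C e + (\<Sum>j\<in>J. M i j *\<^sub>C w' j)"
        by (simp only: w scaleC_add_right scaleC_scaleC sum.distrib scaleC_sum_left)
      moreover have "cinner (\<Sum>j\<in>J. M i j *\<^sub>C w' j) e = 0"
        by (simp add: cinner_sum_left cinner_scaleC_left orth)
      ultimately show ?thesis by (simp add: norm_orthogonal_split[OF e])
    qed
    have col: "(norm (w j))\<^sup>2 = (cmod (a j))\<^sup>2 + (norm (w' j))\<^sup>2" for j
      using norm_orthogonal_split[OF e orth[of j], of "a j"] by (simp add: w[symmetric])
    show ?thesis
      using add_mono[OF bound[of a] IH] by (simp add: row col sum.distrib distrib_left)
  qed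
qed

text \<open>A crude bound, whose only purpose is to make the supremum that defines the norm of \<open>Q(X)\<close>
  one over a bounded set.\<close>

lemma matrix_bound_frobenius:
  fixes M :: "'i \<Rightarrow> 'j \<Rightarrow> complex"
  shows "(\<Sum>i\<in>I. (cmod (\<Sum>j\<in>J. M i j * z j))\<^sup>2)
    \<le> (\<Sum>i\<in>I. \<Sum>j\<in>J. (cmod (M i j))\<^sup>2) * (\<Sum>j\<in>J. (cmod (z j))\<^sup>2)"
proof -
  have "(cmod (\<Sum>j\<in>J. M i j * z j))\<^sup>2
      \<le> (\<Sum>j\<in>J. (cmod (M i j))\<^sup>2) * (\<Sum>j\<in>J. (cmod (z j))\<^sup>2)" for i
  proof -
    have "cmod (\<Sum>j\<in>J. M i j * z j) \<le> (\<Sum>j\<in>J. cmod (M i j) * cmod (z j))"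
      by (rule order_trans[OF norm_sum]) (simp add: norm_mult)
    then have "(cmod (\<Sum>j\<in>J. M i j * z j))\<^sup>2 \<le> (\<Sum>j\<in>J. cmod (M i j) * cmod (z j))\<^sup>2"
      by (intro power_mono) auto
    also have "\<dots> \<le> (\<Sum>j\<in>J. (cmod (M i j))\<^sup>2) * (\<Sum>j\<in>J. (cmod (z j))\<^sup>2)"
      by (rule Cauchy_Schwarz_ineq_sum)
    finally show ?thesis .
  qed
  then show ?thesis
    unfolding sum_distrib_right by (intro sum_mono) (simp add: sum_distrib_right)
qed


section \<open>The norm on an ampliated space\<close>

lemma amp_norm_nonneg [simp]: "0 \<le> amp_norm n v"
  by (simp add: amp_norm_def)

lemma amp_norm_zero [simp]: "amp_norm n (\<lambda>_. 0) = 0"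
  by (simp add: amp_norm_def L2_set_def)

lemma amp_norm_power2: "(amp_norm n v)\<^sup>2 = (\<Sum>i<n. (norm (v i))\<^sup>2)"
  by (simp add: amp_norm_def L2_set_def sum_nonneg)

lemma amp_norm_mono:
  "(\<And>i. i < n \<Longrightarrow> norm (v i) \<le> norm (w i)) \<Longrightarrow> amp_norm n v \<le> amp_norm n w"
  unfolding amp_norm_def by (rule L2_set_mono) auto

lemma norm_le_amp_norm: "i < n \<Longrightarrow> norm (v i) \<le> amp_norm n v"
  unfolding amp_norm_def by (rule member_le_L2_set) auto

lemma amp_norm_triangle: "amp_norm n (\<lambda>i. v i + w i) \<le> amp_norm n v + amp_norm n w"
proof -
  have "amp_norm n (\<lambda>i. v i + w i) \<le> L2_set (\<lambda>i. norm (v i) + norm (w i)) {..<n}"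
    unfolding amp_norm_def by (rule L2_set_mono) (auto intro: norm_triangle_ineq)
  also have "\<dots> \<le> amp_norm n v + amp_norm n w"
    unfolding amp_norm_def by (rule L2_set_triangle_ineq)
  finally show ?thesis .
qed

lemma amp_norm_scaleC: "amp_norm n (\<lambda>i. c *\<^sub>C v i) = cmod c * amp_norm n v"
  by (simp add: amp_norm_def norm_scaleC L2_set_right_distrib)

lemma amp_norm_pos:
  assumes "v \<in> amp n" "v \<noteq> (\<lambda>_. 0)"
  shows "0 < amp_norm n v"
proof -
  obtain i where "v i \<noteq> 0" using assms(2) by auto
  then have "i < n" using assms(1) by (force simp: amp_def not_le[symmetric])
  then have "norm (v i) \<le> amp_norm n v" by (rule norm_le_amp_norm)
  then show ?thesis using \<open>v i \<noteq> 0\<close> by (meson less_le_trans zero_less_norm_iff)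
qed

lemma amp_norm_vec_power2:
  fixes v :: "nat \<Rightarrow> ('h::complex_hilbert) ^ 'm::finite"
  shows "(amp_norm n v)\<^sup>2 = (\<Sum>p\<in>{..<n}\<times>UNIV. (norm (v (fst p) $ snd p))\<^sup>2)"
proof -
  have "(norm (x :: 'h ^ 'm))\<^sup>2 = (\<Sum>a\<in>UNIV. (norm (x $ a))\<^sup>2)" for x
    by (simp add: norm_vec_def L2_set_def sum_nonneg)
  then show ?thesis
    by (simp add: amp_norm_power2 sum.cartesian_product split_def)
qed

text \<open>The Banach fixed point argument, applied to \<open>v \<mapsto> z + R v\<close>. The space \<open>amp n\<close> is a set of
  sequences and carries no metric of its own, so the iteration is shown to converge coordinate by
  coordinate, and the limit is identified through the contraction bound for \<open>R\<close>.\<close>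

lemma amp_fixed_point:
  fixes R :: "(nat \<Rightarrow> 'a::complex_hilbert) \<Rightarrow> nat \<Rightarrow> 'a"
  assumes amp: "\<And>v. v \<in> amp n \<Longrightarrow> R v \<in> amp n"
    and diff: "\<And>v w. R (\<lambda>i. v i - w i) = (\<lambda>i. R v i - R w i)"
    and bound: "\<And>v. v \<in> amp n \<Longrightarrow> amp_norm n (R v) \<le> c * amp_norm n v"
    and c: "0 \<le> c" "c < 1" and z: "z \<in> amp n"
  shows "\<exists>u\<in>amp n. (\<lambda>i. u i - R u i) = z"
proof -
  define U where "U = rec_nat (\<lambda>_::nat. 0::'a) (\<lambda>_ v i. z i + R v i)"
  have U0: "U 0 = (\<lambda>_. 0)" and US: "U (Suc k) = (\<lambda>i. z i + R (U k) i)" for k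
    by (simp_all add: U_def)
  have Uamp: "U k \<in> amp n" for k
    by (induction k) (use amp z in \<open>auto simp: U0 US amp_def\<close>)
  have diff_amp: "(\<lambda>i. v i - w i) \<in> amp n" if "v \<in> amp n" "w \<in> amp n" for v w :: "nat \<Rightarrow> 'a"
    using that by (auto simp: amp_def)
  define K where "K = amp_norm n (\<lambda>i. U 1 i - U 0 i)"
  have step: "amp_norm n (\<lambda>i. U (Suc k) i - U k i) \<le> K * c ^ k" for k
  proof (induction k)
    case 0
    then show ?case by (simp add: K_def)
  next
    case (Suc k)
    have "(\<lambda>i. U (Suc (Suc k)) i - U (Suc k) i) = R (\<lambda>i. U (Suc k) i - U k i)"
      unfolding diff by (simp add: US[of "Suc k"] US[of k] fun_eq_iff)
    then have "amp_norm n (\<lambda>i. U (Suc (Suc k)) i - U (Suc k) i)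
        \<le> c * amp_norm n (\<lambda>i. U (Suc k) i - U k i)"
      using bound[OF diff_amp[OF Uamp Uamp]] by simp
    also have "\<dots> \<le> c * (K * c ^ k)"
      using Suc c by (intro mult_left_mono)
    finally show ?case by (simp add: mult_ac)
  qed
  have conv: "convergent (\<lambda>k. U k i)" for i
  proof (cases "i < n")
    case True
    have le: "norm (U (Suc k) i - U k i) \<le> K * c ^ k" for k
      using norm_le_amp_norm[OF True, of "\<lambda>i. U (Suc k) i - U k i"] step[of k] by simp
    have "summable (\<lambda>k. K * c ^ k)"
      using c by (intro summable_mult summable_geometric) simp
    then have "summable (\<lambda>k. U (Suc k) i - U k i)"
      by (rule summable_comparison_test'[where N = 0]) (rule le)
    then show ?thesis
      by (simp add: summable_iff_convergent sum_lessThan_telescope[of "\<lambda>k. U k i"] U0)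
  next
    case False
    then have "U k i = 0" for k using Uamp[of k] by (auto simp: amp_def)
    then show ?thesis by (simp add: convergent_const)
  qed
  define u where "u i = lim (\<lambda>k. U k i)" for i
  have lim: "(\<lambda>k. U k i) \<longlonglongrightarrow> u i" for i
    using conv[of i] by (simp add: u_def convergent_LIMSEQ_iff)
  have u: "u \<in> amp n"
  proof -
    have "u i = 0" if "i \<ge> n" for i
    proof -
      have "U k i = 0" for k using Uamp[of k] that by (auto simp: amp_def)
      then show ?thesis using lim[of i] by (simp add: LIMSEQ_const_iff)
    qed
    then show ?thesis by (simp add: amp_def)
  qed
  have "(\<lambda>k. L2_set (\<lambda>i. norm (U k i - u i)) {..<n}) \<longlonglongrightarrow> L2_set (\<lambda>i. norm (u i - u i)) {..<n}"
    unfolding L2_set_def by (intro tendsto_intros lim)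
  then have norm_lim: "(\<lambda>k. amp_norm n (\<lambda>i. U k i - u i)) \<longlonglongrightarrow> 0"
    by (simp add: amp_norm_def L2_set_def)
  have "u i - R u i = z i" for i
  proof (cases "i < n")
    case True
    have le: "norm (R (U k) i - R u i) \<le> c * amp_norm n (\<lambda>i. U k i - u i)" for k
      using norm_le_amp_norm[OF True, of "R (\<lambda>i. U k i - u i)"] bound[OF diff_amp[OF Uamp[of k] u]]
      by (simp add: diff)
    have "(\<lambda>k. R (U k) i - R u i) \<longlonglongrightarrow> 0"
      by (rule Lim_null_comparison[OF always_eventually[OF allI[OF le]]
            tendsto_mult_right_zero[OF norm_lim]])
    then have "(\<lambda>k. R (U k) i) \<longlonglongrightarrow> R u i"
      by (simp add: LIM_zero_iff)
    then have "(\<lambda>k. U (Suc k) i) \<longlonglongrightarrow> z i + R u i"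
      unfolding US by (intro tendsto_intros)
    then have "u i = z i + R u i"
      using LIMSEQ_unique[OF LIMSEQ_Suc[OF lim[of i]]] by blast
    then show ?thesis by simp
  next
    case False
    then show ?thesis using u amp[OF u] z by (auto simp: amp_def)
  qed
  then show ?thesis using u by (intro bexI[of _ u]) auto
qed


section \<open>The operator \<open>Q(X) \<otimes> I\<close>\<close>

text \<open>The scalar matrix of \<open>Q(X)\<close>, its rows and columns indexed by pairs of a coordinate in \<open>\<complex>\<^sup>n\<close>
  and one in \<open>\<complex>\<^sup>s\<close> or \<open>\<complex>\<^sup>r\<close>. The same matrix describes \<open>Q(X) \<otimes> I\<^sub>\<H>\<close> for every \<open>\<H>\<close>, which is
  what allows bounds to pass from \<open>\<complex>\<close> to \<open>\<H>\<close>.\<close>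

definition Q_coeff ::
  "('d::finite \<Rightarrow> complex ^ 'r ^ 's) \<Rightarrow> ('d \<Rightarrow> complex mat)
    \<Rightarrow> nat \<times> 's \<Rightarrow> nat \<times> 'r \<Rightarrow> complex" where
  "Q_coeff Q X p q = (\<Sum>j\<in>UNIV. Q j $ snd p $ snd q * X j $$ (fst p, fst q))"

lemma Q_op_nth:
  fixes Q :: "'d::finite \<Rightarrow> complex ^ 'r::finite ^ 's::finite"
    and v :: "nat \<Rightarrow> ('h::complex_hilbert) ^ 'r"
  assumes "i < n"
  shows "Q_op Q n X v i $ a
    = (\<Sum>q\<in>{..<n}\<times>UNIV. Q_coeff Q X (i, a) q *\<^sub>C (v (fst q) $ snd q))"
proof -
  have "Q_op Q n X v i $ a
      = (\<Sum>j\<in>UNIV. \<Sum>b\<in>UNIV. \<Sum>k<n. (Q j $ a $ b * X j $$ (i, k)) *\<^sub>C (v k $ b))"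
    using assms
    by (simp add: Q_op_def tensor_id_def mat_act_def sum_component
        scaleC_sum_right scaleC_scaleC)
  also have "\<dots> = (\<Sum>k<n. \<Sum>b\<in>UNIV. \<Sum>j\<in>UNIV. (Q j $ a $ b * X j $$ (i, k)) *\<^sub>C (v k $ b))"
    by (subst sum.swap, rule trans[OF _ sum.swap], rule sum.cong[OF refl], rule sum.swap)
  also have "\<dots> = (\<Sum>k<n. \<Sum>b\<in>UNIV. Q_coeff Q X (i, a) (k, b) *\<^sub>C (v k $ b))"
    by (simp add: Q_coeff_def scaleC_sum_left)
  also have "\<dots> = (\<Sum>q\<in>{..<n}\<times>UNIV. Q_coeff Q X (i, a) q *\<^sub>C (v (fst q) $ snd q))"
    by (simp add: sum.cartesian_product split_def)
  finally show ?thesis .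
qed

lemma Q_op_outside: "n \<le> i \<Longrightarrow> Q_op Q n X v i = 0"
  by (simp add: Q_op_def mat_act_def tensor_id_def flip: zero_vec_def)

lemma Q_op_amp: "Q_op Q n X v \<in> amp n"
  by (simp add: amp_def Q_op_outside)

lemma Q_op_eqI:
  assumes "\<And>i a. i < n \<Longrightarrow> Q_op Q n X v i $ a = w i $ a" "\<And>i. n \<le> i \<Longrightarrow> w i = 0"
  shows "Q_op Q n X v = w"
proof
  fix i
  show "Q_op Q n X v i = w i"
    by (cases "i < n") (auto simp: Finite_Cartesian_Product.vec_eq_iff assms Q_op_outside)
qed

lemma Q_op_add: "Q_op Q n X (\<lambda>i. v i + w i) = (\<lambda>i. Q_op Q n X v i + Q_op Q n X w i)"
  by (rule Q_op_eqI) (simp_all add: Q_op_nth Q_op_outside scaleC_add_right sum.distrib)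

lemma Q_op_diff: "Q_op Q n X (\<lambda>i. v i - w i) = (\<lambda>i. Q_op Q n X v i - Q_op Q n X w i)"
  by (rule Q_op_eqI) (simp_all add: Q_op_nth Q_op_outside scaleC_diff_right sum_subtractf)

lemma Q_op_scaleC: "Q_op Q n X (\<lambda>i. c *\<^sub>C v i) = (\<lambda>i. c *\<^sub>C Q_op Q n X v i)"
  by (rule Q_op_eqI)
    (simp_all add: Q_op_nth Q_op_outside scaleC_scaleC scaleC_sum_right mult.commute)

lemma Q_op_smult:
  assumes "X \<in> level n"
  shows "Q_op Q n (\<lambda>j. c \<cdot>\<^sub>m X j) v = (\<lambda>i. c *\<^sub>C Q_op Q n X v i)"
proof (rule Q_op_eqI)
  fix i a assume i: "i < n"
  have "Q_coeff Q (\<lambda>j. c \<cdot>\<^sub>m X j) (i, a) q = c * Q_coeff Q X (i, a) q"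
    if "q \<in> {..<n} \<times> UNIV" for q
  proof -
    have "(c \<cdot>\<^sub>m X j) $$ (i, fst q) = c * X j $$ (i, fst q)" for j
      using i that assms by (auto simp: level_def carrier_matD dest!: spec[of _ j])
    then show ?thesis by (simp add: Q_coeff_def sum_distrib_left mult_ac)
  qed
  then show "Q_op Q n (\<lambda>j. c \<cdot>\<^sub>m X j) v i $ a = (c *\<^sub>C Q_op Q n X v i) $ a"
    using i by (simp add: Q_op_nth scaleC_sum_right scaleC_scaleC)
qed (simp add: Q_op_outside)

lemma Q_op_norm_power2:
  fixes Q :: "'d::finite \<Rightarrow> complex ^ 'r::finite ^ 's::finite"
    and v :: "nat \<Rightarrow> ('h::complex_hilbert) ^ 'r"
  shows "(amp_norm n (Q_op Q n X v))\<^sup>2 = (\<Sum>p\<in>{..<n}\<times>UNIV.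
      (norm (\<Sum>q\<in>{..<n}\<times>UNIV. Q_coeff Q X p q *\<^sub>C (v (fst q) $ snd q)))\<^sup>2)"
  unfolding amp_norm_vec_power2 by (intro sum.cong refl) (auto simp: Q_op_nth)

lemma Q_op_bdd_above:
  fixes Q :: "'d::finite \<Rightarrow> complex ^ 'r::finite ^ 's::finite"
  shows "bdd_above ((\<lambda>v. amp_norm n (Q_op Q n X v)) `
    {v :: nat \<Rightarrow> complex ^ 'r. v \<in> amp n \<and> amp_norm n v \<le> 1})"
proof -
  let ?F = "(\<Sum>p\<in>{..<n}\<times>UNIV. \<Sum>q\<in>{..<n}\<times>UNIV. (cmod (Q_coeff Q X p q))\<^sup>2)"
  show ?thesis
  proof (rule bdd_aboveI2)
    fix v :: "nat \<Rightarrow> complex ^ 'r"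
    assume "v \<in> {v. v \<in> amp n \<and> amp_norm n v \<le> 1}"
    then have v1: "(amp_norm n v)\<^sup>2 \<le> 1" by (simp add: power_le_one)
    have F: "0 \<le> ?F" by (intro sum_nonneg) auto
    have "(amp_norm n (Q_op Q n X v))\<^sup>2 \<le> ?F * (amp_norm n v)\<^sup>2"
      using matrix_bound_frobenius[where I = "{..<n}\<times>UNIV" and J = "{..<n}\<times>UNIV" and M = "Q_coeff Q X"
          and z = "\<lambda>q. v (fst q) $ snd q"]
      unfolding Q_op_norm_power2 by (simp add: amp_norm_vec_power2 scaleC_complex_def)
    also have "\<dots> \<le> ?F"
      using mult_left_mono[OF v1 F] by simp
    finally show "amp_norm n (Q_op Q n X v) \<le> sqrt ?F"
      by (rule real_le_rsqrt)
  qed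
qed

lemma Q_op_zero: "Q_op Q n X (\<lambda>_. 0) = (\<lambda>_. 0)"
  using Q_op_diff[of Q n X "\<lambda>_. 0" "\<lambda>_. 0"] by simp

lemma Q_norm_nonneg: "0 \<le> Q_norm Q n X"
  unfolding Q_norm_def amp_opnorm_def
  by (rule cSUP_upper2[OF Q_op_bdd_above, of "\<lambda>_. 0"]) (auto simp: amp_def)

lemma Q_op_bound_scalar:
  fixes Q :: "'d::finite \<Rightarrow> complex ^ 'r::finite ^ 's::finite"
    and v :: "nat \<Rightarrow> complex ^ 'r"
  assumes "v \<in> amp n"
  shows "amp_norm n (Q_op Q n X v) \<le> Q_norm Q n X * amp_norm n v"
proof (cases "v = (\<lambda>_. 0)")
  case True
  then show ?thesis by (simp add: Q_op_zero)
next
  case False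
  define c where "c = amp_norm n v"
  have c: "c > 0" using amp_norm_pos[OF assms False] by (simp add: c_def)
  define v' where "v' = (\<lambda>i. complex_of_real (1 / c) *\<^sub>C v i)"
  have "v' \<in> amp n" "amp_norm n v' \<le> 1"
    using assms c by (auto simp: v'_def amp_def amp_norm_scaleC norm_divide simp flip: c_def)
  then have "amp_norm n (Q_op Q n X v') \<le> Q_norm Q n X"
    unfolding Q_norm_def amp_opnorm_def by (intro cSUP_upper[OF _ Q_op_bdd_above]) auto
  moreover have "amp_norm n (Q_op Q n X v') = amp_norm n (Q_op Q n X v) / c"
    using c unfolding v'_def Q_op_scaleC amp_norm_scaleC by (simp add: norm_divide)
  ultimately show ?thesis using c by (simp add: field_simps flip: c_def)
qed

lemma Q_op_bound:
  fixes Q :: "'d::finite \<Rightarrow> complex ^ 'r::finite ^ 's::finite"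
    and v :: "nat \<Rightarrow> ('h::complex_hilbert) ^ 'r"
  shows "amp_norm n (Q_op Q n X v) \<le> Q_norm Q n X * amp_norm n v"
proof (rule power2_le_imp_le)
  let ?I = "{..<n} \<times> (UNIV :: 's set)" and ?J = "{..<n} \<times> (UNIV :: 'r set)"
  have "(\<Sum>p\<in>?I. (cmod (\<Sum>q\<in>?J. Q_coeff Q X p q * z q))\<^sup>2)
      \<le> (Q_norm Q n X)\<^sup>2 * (\<Sum>q\<in>?J. (cmod (z q))\<^sup>2)" for z
  proof -
    define u where "u i = (if i < n then \<chi> b. z (i, b) else 0)" for i
    have u: "u \<in> amp n" by (simp add: amp_def u_def)
    have z: "z q = u (fst q) $ snd q" if "q \<in> ?J" for q
      using that by (auto simp: u_def)
    have "(amp_norm n (Q_op Q n X u))\<^sup>2 \<le> (Q_norm Q n X * amp_norm n u)\<^sup>2"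
      by (rule power_mono[OF Q_op_bound_scalar[OF u]]) simp
    then show ?thesis
      unfolding Q_op_norm_power2
      by (simp add: amp_norm_vec_power2 power_mult_distrib scaleC_complex_def z cong: sum.cong)
  qed
  from matrix_bound_tensor_hilbert[where J = ?J and I = ?I and w = "\<lambda>q. v (fst q) $ snd q", OF _ this]
  show "(amp_norm n (Q_op Q n X v))\<^sup>2 \<le> (Q_norm Q n X * amp_norm n v)\<^sup>2"
    unfolding Q_op_norm_power2 by (simp add: amp_norm_vec_power2 power_mult_distrib)
qed (simp add: Q_norm_nonneg)

lemma Q_norm_smult_le:
  assumes "X \<in> level n" "0 \<le> t"
  shows "Q_norm Q n (\<lambda>j. complex_of_real t \<cdot>\<^sub>m X j) \<le> t * Q_norm Q n X"
  unfolding Q_norm_def[of Q n "\<lambda>j. complex_of_real t \<cdot>\<^sub>m X j"] amp_opnorm_def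
proof (rule cSUP_least)
  show "{v :: nat \<Rightarrow> complex ^ 'b. v \<in> amp n \<and> amp_norm n v \<le> 1} \<noteq> {}"
    by (auto simp: amp_def amp_norm_def L2_set_def intro!: exI[of _ "\<lambda>_. 0"])
  fix v :: "nat \<Rightarrow> complex ^ 'b"
  assume "v \<in> {v. v \<in> amp n \<and> amp_norm n v \<le> 1}"
  then have v: "v \<in> amp n" "amp_norm n v \<le> 1" by auto
  have "amp_norm n (Q_op Q n (\<lambda>j. complex_of_real t \<cdot>\<^sub>m X j) v) = t * amp_norm n (Q_op Q n X v)"
    using assms by (simp add: Q_op_smult amp_norm_scaleC)
  also have "\<dots> \<le> t * (Q_norm Q n X * 1)"
    using assms v by (intro mult_left_mono order_trans[OF Q_op_bound_scalar[OF v(1)]]) (auto simp: Q_norm_nonneg)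
  finally show "amp_norm n (Q_op Q n (\<lambda>j. complex_of_real t \<cdot>\<^sub>m X j) v) \<le> t * Q_norm Q n X"
    by simp
qed


section \<open>The block unitary\<close>

lemma unitary_inverse:
  assumes "unitary V"
  shows "cinner (V x) y = cinner x (inv_into UNIV V y)" "norm (inv_into UNIV V y) = norm y"
    "inv_into UNIV V (y - z) = inv_into UNIV V y - inv_into UNIV V z" "inv_into UNIV V (V x) = x"
proof -
  have V: "bounded_clinear V" "surj V" and iso: "\<And>x y. cinner (V x) (V y) = cinner x y"
    using assms by (auto simp: unitary_def)
  have norm: "norm (V x) = norm x" for x
    using iso[of x x] by (simp only: cinner_same of_real_eq_iff) simp
  have "inj V"
  proof (rule injI)
    fix a b assume "V a = V b"
    then have "V (a - b) = 0" by (simp add: bounded_clinearD(3)[OF V(1)])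
    then show "a = b" using norm[of "a - b"] by simp
  qed
  note inv = inv_f_f[OF \<open>inj V\<close>] surj_f_inv_f[OF V(2)]
  show "inv_into UNIV V (V x) = x" by (rule inv)
  show "cinner (V x) y = cinner x (inv_into UNIV V y)" using iso[of x "inv_into UNIV V y"] by (simp add: inv)
  show "norm (inv_into UNIV V y) = norm y" using norm[of "inv_into UNIV V y"] by (simp add: inv)
  have "V (inv_into UNIV V y - inv_into UNIV V z) = y - z" by (simp add: bounded_clinearD(3)[OF V(1)] inv)
  then show "inv_into UNIV V (y - z) = inv_into UNIV V y - inv_into UNIV V z" using inv(1)[of "inv_into UNIV V y - inv_into UNIV V z"] by simp
qed

text \<open>Adjoints are unique, so exhibiting one determines the definite description.\<close>

lemma cadjoint_eqI:
  assumes "\<And>x y. cinner (T x) y = cinner x (T' y)"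
  shows "cadjoint T = T'"
  unfolding cadjoint_def
proof (rule the_equality)
  fix S assume S: "\<forall>x y. cinner (T x) y = cinner x (S y)"
  show "S = T'"
  proof
    fix y show "S y = T' y"
      by (rule cinner_right_eqI) (use S assms in metis)
  qed
qed (use assms in blast)

text \<open>The adjoint of a corner of \<open>V\<close> is the matching corner of \<open>V\<^sup>* = V\<inverse>\<close>. This also proves
  that \<open>D\<close> has an adjoint, so that \<open>cadjoint D\<close> is meaningful.\<close>

lemma block_unitary_cadjoint:
  assumes "bounded_clinear A" "bounded_clinear C" and V: "unitary (block_op A B C D)"
  shows "cadjoint D = (\<lambda>w. snd (inv_into UNIV (block_op A B C D) (0, w)))"
    and "cinner (D u) w = cinner u (cadjoint D w)"
proof -
  let ?W = "inv_into UNIV (block_op A B C D)"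
  have adj: "cinner (D u) w = cinner u (snd (?W (0, w)))" for u w
  proof -
    have "cinner (D u) w = cinner (block_op A B C D (0, u)) (0, w)"
      by (simp add: block_op_def cinner_prod_def bounded_clinearD(1)[OF assms(1)]
          bounded_clinearD(1)[OF assms(2)])
    also have "\<dots> = cinner (0, u) (?W (0, w))"
      by (rule unitary_inverse(1)[OF V])
    also have "\<dots> = cinner u (snd (?W (0, w)))"
      by (simp add: cinner_prod_def)
    finally show ?thesis .
  qed
  show "cadjoint D = (\<lambda>w. snd (?W (0, w)))"
    by (rule cadjoint_eqI) (rule adj)
  then show "cinner (D u) w = cinner u (cadjoint D w)"
    by (simp add: adj)
qed


section \<open>State vectors of the realization\<close>

text \<open>The vector \<open>w\<close> is \<open>C y + D u\<close> for the \<open>u\<close> at which the inverse in the realization is taken.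
  The identity \<open>V (y, Q(X) w) = (f(X) y, w)\<close> in each coordinate of \<open>\<complex>\<^sup>n\<close> gives the energy balance
  by isometry and the eigenvector defect by inverting \<open>V\<close>.\<close>

lemma realization_state:
  fixes Q :: "'d::finite \<Rightarrow> complex ^ 'r::finite ^ 's::finite"
    and A :: "complex \<Rightarrow> complex"
    and B :: "('h::complex_hilbert) ^ 's \<Rightarrow> complex"
    and C :: "complex \<Rightarrow> 'h ^ 'r"
    and D :: "'h ^ 's \<Rightarrow> 'h ^ 'r"
  assumes A: "bounded_clinear A" and C: "bounded_clinear C" and D: "bounded_clinear D"
    and V: "unitary (block_op A B C D)"
    and X: "Q_norm Q n X < 1" and y: "y \<in> amp n"
  obtains w where "w \<in> amp n"
    "(amp_norm n y)\<^sup>2 + (amp_norm n (Q_op Q n X w))\<^sup>2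
      = (amp_norm n (transfer_op Q A B C D n X y))\<^sup>2 + (amp_norm n w)\<^sup>2"
    "amp_norm n (\<lambda>i. ampliate (cadjoint D) w i - Q_op Q n X w i)
      \<le> amp_norm n (transfer_op Q A B C D n X y)"
proof -
  let ?V = "block_op A B C D" and ?P = "Q_op Q n X :: (nat \<Rightarrow> 'h ^ 'r) \<Rightarrow> nat \<Rightarrow> 'h ^ 's"
  let ?G = "\<lambda>u i. u i - ?P (ampliate D u) i" and ?z = "?P (ampliate C y)"
  let ?g = "transfer_op Q A B C D n X y"
  note inverse = unitary_inverse[OF V]
  have V_iso: "(norm (?V p))\<^sup>2 = (norm p)\<^sup>2" for p
    using inverse(2)[of "?V p"] by (simp add: inverse(4))
  have D_contraction: "norm (D x) \<le> norm x" for x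
  proof -
    have "norm (D x) \<le> norm (?V (0, x))"
      using bounded_clinearD(1)[OF A] bounded_clinearD(1)[OF C]
      by (simp add: block_op_def norm_Pair)
    then show ?thesis using V_iso[of "(0, x)"] by (simp add: norm_Pair)
  qed
  have fixed: "\<exists>u\<in>amp n. ?G u = ?z"
  proof (rule amp_fixed_point[where c = "Q_norm Q n X"])
    show "?P (ampliate D (\<lambda>i. v i - v' i)) = (\<lambda>i. ?P (ampliate D v) i - ?P (ampliate D v') i)" for v v'
      by (simp add: ampliate_def bounded_clinearD(3)[OF D] Q_op_diff)
    show "amp_norm n (?P (ampliate D v)) \<le> Q_norm Q n X * amp_norm n v" for v
      by (rule order_trans[OF Q_op_bound], rule mult_left_mono[OF amp_norm_mono])
        (auto simp: ampliate_def D_contraction Q_norm_nonneg)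
  qed (use X in \<open>auto simp: Q_op_amp Q_norm_nonneg\<close>)
  (* Being in the range of ?G is what makes the inv_into of the realization a true preimage. *)
  have z: "?z \<in> ?G ` amp n"
    by (rule bexE[OF fixed]) (rule image_eqI, rule sym)
  define u where "u = inv_into (amp n) ?G ?z"
  have u: "u \<in> amp n" and Gu: "?G u = ?z"
    unfolding u_def by (rule inv_into_into[OF z], rule f_inv_into_f[OF z])
  define w where "w i = ampliate C y i + ampliate D u i" for i
  have w: "w \<in> amp n"
    using y u by (simp add: w_def amp_def ampliate_def bounded_clinearD(1)[OF C] bounded_clinearD(1)[OF D])
  have "w = (\<lambda>i. ampliate C y i + ampliate D u i)"
    by (simp add: w_def fun_eq_iff)
  then have "?P w = (\<lambda>i. ?z i + ?P (ampliate D u) i)"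
    by (simp only: Q_op_add)
  also have "\<dots> = u"
    unfolding Gu[symmetric] by simp
  finally have Pw: "?P w = u" .
  have g: "?g i = A (y i) + B (u i)" for i
    by (simp add: transfer_op_def ampliate_def u_def)
  have Vyu: "?V (y i, u i) = (?g i, w i)" for i
    by (simp add: block_op_def g w_def ampliate_def)
  have energy: "(norm (y i))\<^sup>2 + (norm (u i))\<^sup>2 = (norm (?g i))\<^sup>2 + (norm (w i))\<^sup>2" for i
    using V_iso[of "(y i, u i)"] by (simp add: Vyu norm_Pair)
  have defect: "norm (cadjoint D (w i) - u i) \<le> norm (?g i)" for i
  proof -
    have "inv_into UNIV ?V (0, w i) = inv_into UNIV ?V (?g i, w i) - inv_into UNIV ?V (?g i, 0)"
      by (simp flip: inverse(3))
    also have "\<dots> = (y i, u i) - inv_into UNIV ?V (?g i, 0)"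
      using inverse(4)[of "(y i, u i)"] by (simp only: Vyu)
    finally have "cadjoint D (w i) = u i - snd (inv_into UNIV ?V (?g i, 0))"
      by (simp only: block_unitary_cadjoint(1)[OF A C V] snd_diff snd_conv)
    then have "norm (cadjoint D (w i) - u i) \<le> norm (inv_into UNIV ?V (?g i, 0))"
      using norm_snd_le[where y = "snd (inv_into UNIV ?V (?g i, 0))" and x = "fst (inv_into UNIV ?V (?g i, 0))"]
      by simp
    then show ?thesis by (simp add: inverse(2) norm_Pair)
  qed
  show thesis
  proof (rule that[OF w])
    show "(amp_norm n y)\<^sup>2 + (amp_norm n (?P w))\<^sup>2 = (amp_norm n ?g)\<^sup>2 + (amp_norm n w)\<^sup>2"
      by (simp add: Pw amp_norm_power2 energy flip: sum.distrib)
    show "amp_norm n (\<lambda>i. ampliate (cadjoint D) w i - ?P w i) \<le> amp_norm n ?g"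
      using defect by (intro amp_norm_mono) (simp add: Pw ampliate_def)
  qed
qed

text \<open>By homogeneity the approximate eigenvectors may be left unnormalized, and the defining
  sequence may be replaced by one vector for each tolerance.\<close>

lemma approx_spectrumI:
  fixes T :: "('h::complex_hilbert) ^ 'r::finite \<Rightarrow> 'h ^ 's::finite"
  assumes "n \<ge> 1" "X \<in> level n" and T: "\<And>c x. T (c *\<^sub>C x) = c *\<^sub>C T x"
    and ex: "\<And>e. e > 0 \<Longrightarrow> \<exists>w\<in>amp n. 0 < amp_norm n w \<and>
      amp_norm n (\<lambda>i. ampliate T w i - Q_op Q n X w i) \<le> e * amp_norm n w"
  shows "X \<in> approx_spectrum Q T"
proof -
  have "\<exists>v. v \<in> amp n \<and> amp_norm n v = 1 \<and>
      amp_norm n (\<lambda>i. ampliate T v i - Q_op Q n X v i) \<le> 1 / real (Suc k)" for k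
  proof -
    have "0 < 1 / real (Suc k)" by simp
    from ex[OF this] obtain w where w: "w \<in> amp n" "0 < amp_norm n w"
      and le: "amp_norm n (\<lambda>i. ampliate T w i - Q_op Q n X w i) \<le> 1 / real (Suc k) * amp_norm n w"
      by blast
    define c where "c = complex_of_real (1 / amp_norm n w)"
    have c: "cmod c = 1 / amp_norm n w" by (simp add: c_def norm_divide)
    have "(\<lambda>i. ampliate T (\<lambda>i. c *\<^sub>C w i) i - Q_op Q n X (\<lambda>i. c *\<^sub>C w i) i)
        = (\<lambda>i. c *\<^sub>C (ampliate T w i - Q_op Q n X w i))"
      by (simp add: ampliate_def T Q_op_scaleC scaleC_diff_right)
    then have "amp_norm n (\<lambda>i. ampliate T (\<lambda>i. c *\<^sub>C w i) i - Q_op Q n X (\<lambda>i. c *\<^sub>C w i) i)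
        \<le> 1 / real (Suc k)"
      using divide_right_mono[OF le, of "amp_norm n w"] w(2) by (simp add: amp_norm_scaleC c)
    moreover have "(\<lambda>i. c *\<^sub>C w i) \<in> amp n" using w(1) by (simp add: amp_def)
    moreover have "amp_norm n (\<lambda>i. c *\<^sub>C w i) = 1" using w(2) by (simp add: amp_norm_scaleC c)
    ultimately show ?thesis by blast
  qed
  then have "\<exists>v. \<forall>k. v k \<in> amp n \<and> amp_norm n (v k) = 1 \<and>
      amp_norm n (\<lambda>i. ampliate T (v k) i - Q_op Q n X (v k) i) \<le> 1 / real (Suc k)"
    by (intro choice allI)
  then obtain v where v: "\<And>k. v k \<in> amp n \<and> amp_norm n (v k) = 1"
    and le: "\<And>k. amp_norm n (\<lambda>i. ampliate T (v k) i - Q_op Q n X (v k) i) \<le> 1 / real (Suc k)"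
    by blast
  have "(\<lambda>k. amp_norm n (\<lambda>i. ampliate T (v k) i - Q_op Q n X (v k) i)) \<longlonglongrightarrow> 0"
    by (rule tendsto_sandwich[OF _ _ tendsto_const LIMSEQ_inverse_real_of_nat])
      (use le in \<open>auto simp: inverse_eq_divide\<close>)
  then show ?thesis
    using assms(1,2) v unfolding approx_spectrum_def by blast
qed

lemma cadjoint_scaleC:
  assumes "bounded_clinear A" "bounded_clinear C" "unitary (block_op A B C D)"
  shows "cadjoint D (c *\<^sub>C w) = c *\<^sub>C cadjoint D w"
proof (rule cinner_right_eqI)
  fix u
  have adj: "cinner (D u) w = cinner u (cadjoint D w)" for u w
    using block_unitary_cadjoint(2)[OF assms] .
  show "cinner u (cadjoint D (c *\<^sub>C w)) = cinner u (c *\<^sub>C cadjoint D w)"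
    by (simp add: cinner_scaleC_right flip: adj)
qed


section \<open>Boundary zeros\<close>

theorem theorem4:
  fixes Q :: "'d::finite \<Rightarrow> complex ^ 'r::finite ^ 's::finite"
    and f :: "('d \<Rightarrow> complex mat) \<Rightarrow> complex mat"
    and A :: "complex \<Rightarrow> complex"
    and B :: "('h::complex_hilbert) ^ 's \<Rightarrow> complex"
    and C :: "complex \<Rightarrow> 'h ^ 'r"
    and D :: "'h ^ 's \<Rightarrow> 'h ^ 'r"
  assumes lin_indep: "\<And>c :: 'd \<Rightarrow> complex. (\<Sum>j\<in>UNIV. c j *\<^sub>C Q j) = 0 \<Longrightarrow> \<forall>j. c j = 0"
    and f_SA: "f \<in> schur_agler Q"
    and f_nonconst: "\<not> nc_constant Q f"
    and bounded: "bounded_clinear A" "bounded_clinear B" "bounded_clinear C" "bounded_clinear D"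
    and V_unitary: "unitary (block_op A B C D)"
    and realization: "\<And>n X (y :: nat \<Rightarrow> complex). n \<ge> 1 \<Longrightarrow> X \<in> nc_ball Q \<inter> level n \<Longrightarrow> y \<in> amp n
          \<Longrightarrow> mat_act n (f X) y = transfer_op Q A B C D n X y"
  shows "boundary_zeros Q f \<subseteq> approx_spectrum Q (cadjoint D) \<inter> nc_boundary Q"
proof
  fix \<Lambda> assume "\<Lambda> \<in> boundary_zeros Q f"
  then obtain n and y :: "nat \<Rightarrow> complex" where n: "n \<ge> 1" and \<Lambda>: "\<Lambda> \<in> nc_boundary Q" "\<Lambda> \<in> level n"
    and y: "y \<in> amp n" "y \<noteq> (\<lambda>_. 0)"
    and lim: "((\<lambda>t. amp_norm n (mat_act n (f (\<lambda>j. complex_of_real t \<cdot>\<^sub>m \<Lambda> j)) y)) \<longlongrightarrow> 0)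
      (at_left (1::real))"
    unfolding boundary_zeros_def mem_Collect_eq by (elim exE conjE IntE) (rule that)
  obtain m where "\<Lambda> \<in> level m" "Q_norm Q m \<Lambda> = 1"
    using \<Lambda>(1) by (auto simp: nc_boundary_def)
  moreover from this have "m = n"
    using \<Lambda>(2) by (force simp: level_def)
  ultimately have norm: "Q_norm Q n \<Lambda> = 1" by simp
  define a where "a = amp_norm n y"
  have a: "a > 0" using amp_norm_pos[OF y] by (simp add: a_def)
  have "\<Lambda> \<in> approx_spectrum Q (cadjoint D)"
  proof (rule approx_spectrumI[OF n \<Lambda>(2)])
    show "cadjoint D (c *\<^sub>C x) = c *\<^sub>C cadjoint D x" for c x
      by (rule cadjoint_scaleC[OF bounded(1,3) V_unitary])
    fix e :: real assume e: "e > 0"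
    (* d is small enough for norm w >= a/2, and for the defect to be at most e/2 * norm w;
       the other e/2 is spent on replacing t * Q(\<Lambda>) by Q(\<Lambda>). *)
    define d where "d = min (a / 2) (e * a / 4)"
    have "\<forall>\<^sub>F t in at_left 1. amp_norm n (mat_act n (f (\<lambda>j. complex_of_real t \<cdot>\<^sub>m \<Lambda> j)) y) < d"
      by (rule order_tendstoD(2)[OF lim]) (use a e in \<open>simp add: d_def\<close>)
    moreover have "\<forall>\<^sub>F t in at_left 1. t \<in> {max 0 (1 - e / 2)<..<1::real}"
      by (rule eventually_at_left_real) (use e in simp)
    ultimately have "\<forall>\<^sub>F t in at_left 1. t \<in> {max 0 (1 - e / 2)<..<1::real} \<and>
        amp_norm n (mat_act n (f (\<lambda>j. complex_of_real t \<cdot>\<^sub>m \<Lambda> j)) y) < d"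
      by eventually_elim simp
    then obtain t where t: "0 < t" "1 - e / 2 < t" "t < 1"
      and small: "amp_norm n (mat_act n (f (\<lambda>j. complex_of_real t \<cdot>\<^sub>m \<Lambda> j)) y) < d"
      using eventually_happens[of _ "at_left (1::real)"] by auto
    define X where "X = (\<lambda>j. complex_of_real t \<cdot>\<^sub>m \<Lambda> j)"
    have X: "X \<in> level n" using \<Lambda>(2) by (simp add: X_def level_def)
    have X1: "Q_norm Q n X < 1"
      using Q_norm_smult_le[OF \<Lambda>(2), of t Q] t by (simp add: X_def norm)
    define \<eta> where "\<eta> = amp_norm n (transfer_op Q A B C D n X y)"
    have "X \<in> nc_ball Q \<inter> level n"
      using n X X1 unfolding nc_ball_def by blast
    then have "\<eta> < d"
      using small unfolding X_def[symmetric] \<eta>_def by (simp only: realization[OF n _ y(1)])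
    then have \<eta>: "\<eta> < a / 2" "\<eta> < e * a / 4" by (auto simp: d_def)
    obtain w where w: "w \<in> amp n"
      and energy: "a\<^sup>2 + (amp_norm n (Q_op Q n X w))\<^sup>2 = \<eta>\<^sup>2 + (amp_norm n w)\<^sup>2"
      and defect: "amp_norm n (\<lambda>i. ampliate (cadjoint D) w i - Q_op Q n X w i) \<le> \<eta>"
      by (rule realization_state[OF bounded(1,3,4) V_unitary X1 y(1), folded a_def \<eta>_def])
    have "\<eta>\<^sup>2 \<le> (a / 2)\<^sup>2" using \<eta> by (intro power_mono) (auto simp: \<eta>_def)
    moreover have "(a / 2)\<^sup>2 = a\<^sup>2 / 4" by (simp add: power_divide)
    ultimately have "(a / 2)\<^sup>2 \<le> (amp_norm n w)\<^sup>2"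
      using energy zero_le_power2[of "amp_norm n (Q_op Q n X w)"] zero_le_power2[of a] by linarith
    then have wa: "a / 2 \<le> amp_norm n w"
      by (rule power2_le_imp_le) simp
    have "amp_norm n (\<lambda>i. ampliate (cadjoint D) w i - Q_op Q n \<Lambda> w i)
        = amp_norm n (\<lambda>i. (ampliate (cadjoint D) w i - Q_op Q n X w i)
            + complex_of_real (t - 1) *\<^sub>C Q_op Q n \<Lambda> w i)"
      unfolding X_def Q_op_smult[OF \<Lambda>(2)]
      by (rule arg_cong[where f = "amp_norm n"])
        (simp only: scaleR_scaleC[symmetric], simp add: fun_eq_iff algebra_simps)
    also have "\<dots> \<le> \<eta> + (1 - t) * amp_norm n (Q_op Q n \<Lambda> w)"
      using amp_norm_triangle[of n "\<lambda>i. ampliate (cadjoint D) w i - Q_op Q n X w i"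
          "\<lambda>i. complex_of_real (t - 1) *\<^sub>C Q_op Q n \<Lambda> w i"] defect t
      unfolding amp_norm_scaleC norm_of_real by simp
    also have "\<dots> \<le> e / 2 * amp_norm n w + e / 2 * amp_norm n w"
    proof (rule add_mono)
      have "e * a / 4 = e / 2 * (a / 2)" by simp
      also have "\<dots> \<le> e / 2 * amp_norm n w"
        using e wa by (intro mult_left_mono) auto
      finally show "\<eta> \<le> e / 2 * amp_norm n w" using \<eta>(2) by linarith
      show "(1 - t) * amp_norm n (Q_op Q n \<Lambda> w) \<le> e / 2 * amp_norm n w"
        using t Q_op_bound[of n Q \<Lambda> w] by (intro mult_mono) (auto simp: norm)
    qed
    finally have "amp_norm n (\<lambda>i. ampliate (cadjoint D) w i - Q_op Q n \<Lambda> w i) \<le> e * amp_norm n w"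
      by simp
    then show "\<exists>w\<in>amp n. 0 < amp_norm n w \<and>
        amp_norm n (\<lambda>i. ampliate (cadjoint D) w i - Q_op Q n \<Lambda> w i) \<le> e * amp_norm n w"
      using w wa a by (intro bexI[of _ w]) auto
  qed
  then show "\<Lambda> \<in> approx_spectrum Q (cadjoint D) \<inter> nc_boundary Q" using \<Lambda>(1) by blast
qed

end
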